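(* Let $\kappa\in\{1,-1\}$. Let $F,\tau$ (real-valued, $F\neq0$) and $\lambda$ (complex-valued, with complex conjugate $\bar\lambda$) be functions of the three independent variables $(t,v,\rho)$, and let $$\delta=\partial_t+(\kappa\rho-v^2)\partial_v+\tau\,\partial_\rho,\qquad Y=\partial_v+\lambda\,\partial_\rho,\qquad \bar Y=\partial_v+\bar\lambda\,\partial_\rho$$ be the projected operators of invariant differentiation of the heavenly equation. Then the commutator algebra $$[\delta,Y]=\Bigl(\kappa\bar\lambda-3v-\frac{\delta(F)}{F}\Bigr)Y,\qquad [\delta,\bar Y]=\Bigl(\kappa\lambda-3v-\frac{\delta(F)}{F}\Bigr)\bar Y,\qquad [Y,\bar Y]=\frac{v\rho+\tau}{F}\,(Y-\bar Y)$$ of these operators, together with the Jacobi identity $$\bigl[\delta,[Y,\bar Y]\bigr]+\bigl[Y,[\bar Y,\delta]\bigr]+\bigl[\bar Y,[\delta,Y]\bigr]=0,$$ is equivalent to the resolving system for the heavenly equation, that is, to the following system for the unknowns $F,\lambda,\bar\lambda,\tau$: $$\delta(F)=\bigl[\kappa(\lambda+\bar\lambda)-5v\bigr]F,$$ $$F\bigl(Y(\bar\lambda)-\bar Y(\lambda)\bigr)=(v\rho+\tau)(\lambda-\bar\lambda),$$ $$\delta(\lambda)=Y(\tau)+2v\lambda-\kappa\lambda^2,\qquad \delta(\bar\lambda)=\bar Y(\tau)+2v\bar\lambda-\kappa\bar\lambda^2,$$ $$F\bigl(Y(\bar\lambda)+\bar Y(\lambda)\bigr)=-(v\rho+\tau)(\lambda+\bar\lambda)+2\kappa\bigl[\delta(\tau)+2F+4v\tau+\kappa\rho^2+2v^2\rho\bigr].$$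 Hence the commutator algebra together with the Jacobi identity provides a commutator representation of the resolving system.
   Context: The heavenly equation is $u_{z\bar z}=\kappa(e^u)_{tt}$ for a real function $u(z,\bar z,t)$. The quantities $t$, $v=u_t$, $\rho=e^{-u}u_{z\bar z}$ and $\eta=e^{-u}u_{zt}u_{\bar zt}$ are differential invariants of its infinite-dimensional group of conformal symmetries $z=\phi(\tilde z)$, $u=\tilde u-\ln(\phi'\bar\phi')$. The first three are taken as independent variables and $\eta=F(t,v,\rho)$ is the automorphic equation. Before projection the operators of invariant differentiation are $\delta=D_t$, $Y=\eta^{-1}e^{-u}u_{\bar zt}D_z$, $\bar Y=\eta^{-1}e^{-u}u_{zt}D_{\bar z}$ (with $D$ denoting total derivatives), and $\lambda=Y(\rho)$, $\bar\lambda=\bar Y(\rho)$, $\tau=\delta(\rho)$ are third-order differential invariants, treated as additional unknown functions of $(t,v,\rho)$. The operators $\delta,Y,\bar Y$ in the claim are these operators projected on the solution manifold of the heavenly equation and on the space of the invariants $(t,v,\rho)$; $[\cdot,\cdot]$ is the commutator of operators. The resolving system is the set of compatibility conditions of the heavenly equation and the automorphic equation.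
   Formalization: With the Jacobi identity read literally for the operators, λ≠λ̄ is assumed on a dense set (the claim fails for κ=1, λ=τ=0, F=|ρ−v²|^{5/2}); for arbitrary λ it is imposed on the coefficients of Y and Ȳ taken as formally independent. *)

theory Defs
  imports "HOL-Analysis.Analysis"
begin

text \<open>Points \<open>(t, v, \<rho>)\<close> of the space of invariants.\<close>

type_synonym pt = "real \<times> real \<times> real"
type_synonym fn = "pt \<Rightarrow> complex"

abbreviation vc :: "pt \<Rightarrow> real" where "vc x \<equiv> fst (snd x)"
abbreviation rc :: "pt \<Rightarrow> real" where "rc x \<equiv> snd (snd x)"

text \<open>\<open>Ck_on k U f\<close> is meant for open \<open>U\<close> only; there it says that \<open>f\<close> is of class
  \<open>C\<^sup>k\<close> on \<open>U\<close>. Values of \<open>f\<close> outside \<open>U\<close> are irrelevant.\<close>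

primrec Ck_on :: "nat \<Rightarrow> pt set \<Rightarrow> (pt \<Rightarrow> 'b::real_normed_vector) \<Rightarrow> bool" where
  "Ck_on 0 U f \<longleftrightarrow> continuous_on U f"
| "Ck_on (Suc k) U f \<longleftrightarrow> f differentiable_on U \<and>
     (\<forall>e. Ck_on k U (\<lambda>x. frechet_derivative f (at x) e))"

definition smooth_fn_on :: "pt set \<Rightarrow> (pt \<Rightarrow> 'b::real_normed_vector) \<Rightarrow> bool" where
  "smooth_fn_on U f \<longleftrightarrow> (\<forall>k. Ck_on k U f)"

definition Dt :: "fn \<Rightarrow> fn" where
  "Dt f x = frechet_derivative f (at x) (1, 0, 0)"

definition Dv :: "fn \<Rightarrow> fn" where
  "Dv f x = frechet_derivative f (at x) (0, 1, 0)"

definition Dr :: "fn \<Rightarrow> fn" where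
  "Dr f x = frechet_derivative f (at x) (0, 0, 1)"

definition conj_fn :: "fn \<Rightarrow> fn" where
  "conj_fn l = (\<lambda>x. cnj (l x))"

definition cfn :: "(pt \<Rightarrow> real) \<Rightarrow> fn" where
  "cfn g = (\<lambda>x. complex_of_real (g x))"

definition op_delta :: "real \<Rightarrow> (pt \<Rightarrow> real) \<Rightarrow> fn \<Rightarrow> fn" where
  "op_delta \<kappa> \<tau> f = (\<lambda>x. Dt f x + of_real (\<kappa> * rc x - (vc x)\<^sup>2) * Dv f x + of_real (\<tau> x) * Dr f x)"

definition op_Y :: "fn \<Rightarrow> fn \<Rightarrow> fn" where
  "op_Y l f = (\<lambda>x. Dv f x + l x * Dr f x)"

definition op_Ybar :: "fn \<Rightarrow> fn \<Rightarrow> fn" where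
  "op_Ybar l f = (\<lambda>x. Dv f x + conj_fn l x * Dr f x)"

definition commut :: "(fn \<Rightarrow> fn) \<Rightarrow> (fn \<Rightarrow> fn) \<Rightarrow> fn \<Rightarrow> fn" where
  "commut P Q f = (\<lambda>x. P (Q f) x - Q (P f) x)"

text \<open>Structure functions: \<open>[\<delta>,Y] = coeff_dY Y\<close>, \<open>[\<delta>,Ybar] = coeff_dYbar Ybar\<close>,
  \<open>[Y,Ybar] = coeff_YYbar (Y - Ybar)\<close>.\<close>

definition coeff_dY :: "real \<Rightarrow> (pt \<Rightarrow> real) \<Rightarrow> (pt \<Rightarrow> real) \<Rightarrow> fn \<Rightarrow> fn" where
  "coeff_dY \<kappa> F \<tau> l = (\<lambda>x. of_real \<kappa> * conj_fn l x - 3 * of_real (vc x)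
      - op_delta \<kappa> \<tau> (cfn F) x / of_real (F x))"

definition coeff_dYbar :: "real \<Rightarrow> (pt \<Rightarrow> real) \<Rightarrow> (pt \<Rightarrow> real) \<Rightarrow> fn \<Rightarrow> fn" where
  "coeff_dYbar \<kappa> F \<tau> l = (\<lambda>x. of_real \<kappa> * l x - 3 * of_real (vc x)
      - op_delta \<kappa> \<tau> (cfn F) x / of_real (F x))"

definition coeff_YYbar :: "(pt \<Rightarrow> real) \<Rightarrow> (pt \<Rightarrow> real) \<Rightarrow> fn" where
  "coeff_YYbar F \<tau> = (\<lambda>x. of_real ((vc x * rc x + \<tau> x) / F x))"

definition commutator_algebra ::
  "pt set \<Rightarrow> real \<Rightarrow> (pt \<Rightarrow> real) \<Rightarrow> (pt \<Rightarrow> real) \<Rightarrow> fn \<Rightarrow> bool" where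
  "commutator_algebra U \<kappa> F \<tau> l \<longleftrightarrow>
    (\<forall>f. smooth_fn_on U f \<longrightarrow> (\<forall>x\<in>U.
      commut (op_delta \<kappa> \<tau>) (op_Y l) f x = coeff_dY \<kappa> F \<tau> l x * op_Y l f x \<and>
      commut (op_delta \<kappa> \<tau>) (op_Ybar l) f x = coeff_dYbar \<kappa> F \<tau> l x * op_Ybar l f x \<and>
      commut (op_Y l) (op_Ybar l) f x = coeff_YYbar F \<tau> x * (op_Y l f x - op_Ybar l f x)))"

text \<open>The Jacobi identity for the operators acting on functions of \<open>(t, v, \<rho>)\<close>.
  It always holds for \<open>C\<^sup>2\<close> coefficients. Combined with the commutation relations it
  restricts their structure functions only if \<open>Y\<close> and \<open>Ybar\<close> are linearly independent.\<close>

definition operator_jacobi ::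
  "pt set \<Rightarrow> real \<Rightarrow> (pt \<Rightarrow> real) \<Rightarrow> fn \<Rightarrow> bool" where
  "operator_jacobi U \<kappa> \<tau> l \<longleftrightarrow>
    (\<forall>f. smooth_fn_on U f \<longrightarrow> (\<forall>x\<in>U.
      commut (op_delta \<kappa> \<tau>) (commut (op_Y l) (op_Ybar l)) f x
      + commut (op_Y l) (commut (op_Ybar l) (op_delta \<kappa> \<tau>)) f x
      + commut (op_Ybar l) (commut (op_delta \<kappa> \<tau>) (op_Y l)) f x = 0))"

text \<open>The Jacobi identity in the commutator algebra. Before projection the operators
  \<open>\<delta>, Y, Ybar\<close> are linearly independent over functions, so a triple \<open>(a, b, c)\<close> stands for the
  formal combination \<open>a \<delta> + b Y + c Ybar\<close>, also at points where \<open>l\<close> is real and the coordinate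
  expressions of \<open>Y\<close> and \<open>Ybar\<close> coincide. \<open>comb_bracket\<close> is the
  skew-symmetric bracket of such combinations determined by the commutation relations and the
  Leibniz rule \<open>[X, g Z] = X(g) Z + g [X, Z]\<close>.\<close>

type_synonym comb = "fn \<times> fn \<times> fn"

definition comb_act :: "real \<Rightarrow> (pt \<Rightarrow> real) \<Rightarrow> fn \<Rightarrow> comb \<Rightarrow> fn \<Rightarrow> fn" where
  "comb_act \<kappa> \<tau> l = (\<lambda>(a, b, c) f x.
     a x * op_delta \<kappa> \<tau> f x + b x * op_Y l f x + c x * op_Ybar l f x)"

definition comb_bracket ::
  "real \<Rightarrow> (pt \<Rightarrow> real) \<Rightarrow> (pt \<Rightarrow> real) \<Rightarrow> fn \<Rightarrow> comb \<Rightarrow> comb \<Rightarrow> comb" where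
  "comb_bracket \<kappa> F \<tau> l = (\<lambda>(a, b, c) (a', b', c').
     let X = comb_act \<kappa> \<tau> l (a, b, c); X' = comb_act \<kappa> \<tau> l (a', b', c') in
     (\<lambda>x. X a' x - X' a x,
      \<lambda>x. X b' x - X' b x + (a x * b' x - b x * a' x) * coeff_dY \<kappa> F \<tau> l x
            + (b x * c' x - c x * b' x) * coeff_YYbar F \<tau> x,
      \<lambda>x. X c' x - X' c x + (a x * c' x - c x * a' x) * coeff_dYbar \<kappa> F \<tau> l x
            - (b x * c' x - c x * b' x) * coeff_YYbar F \<tau> x))"

definition comb_add :: "comb \<Rightarrow> comb \<Rightarrow> comb" where
  "comb_add = (\<lambda>(a, b, c) (a', b', c'). (\<lambda>x. a x + a' x, \<lambda>x. b x + b' x, \<lambda>x. c x + c' x))"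

definition comb_zero_on :: "pt set \<Rightarrow> comb \<Rightarrow> bool" where
  "comb_zero_on U = (\<lambda>(a, b, c). \<forall>x\<in>U. a x = 0 \<and> b x = 0 \<and> c x = 0)"

definition gen_delta :: comb where "gen_delta = (\<lambda>x. 1, \<lambda>x. 0, \<lambda>x. 0)"
definition gen_Y :: comb where "gen_Y = (\<lambda>x. 0, \<lambda>x. 1, \<lambda>x. 0)"
definition gen_Ybar :: comb where "gen_Ybar = (\<lambda>x. 0, \<lambda>x. 0, \<lambda>x. 1)"

definition algebra_jacobi ::
  "pt set \<Rightarrow> real \<Rightarrow> (pt \<Rightarrow> real) \<Rightarrow> (pt \<Rightarrow> real) \<Rightarrow> fn \<Rightarrow> bool" where
  "algebra_jacobi U \<kappa> F \<tau> l \<longleftrightarrow>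
    (let br = comb_bracket \<kappa> F \<tau> l in
     comb_zero_on U
       (comb_add (br gen_delta (br gen_Y gen_Ybar))
         (comb_add (br gen_Y (br gen_Ybar gen_delta))
           (br gen_Ybar (br gen_delta gen_Y)))))"

definition resolving_system ::
  "pt set \<Rightarrow> real \<Rightarrow> (pt \<Rightarrow> real) \<Rightarrow> (pt \<Rightarrow> real) \<Rightarrow> fn \<Rightarrow> bool" where
  "resolving_system U \<kappa> F \<tau> l \<longleftrightarrow> (\<forall>x\<in>U.
     op_delta \<kappa> \<tau> (cfn F) x
       = (of_real \<kappa> * (l x + conj_fn l x) - 5 * of_real (vc x)) * of_real (F x) \<and>
     of_real (F x) * (op_Y l (conj_fn l) x - op_Ybar l l x)
       = of_real (vc x * rc x + \<tau> x) * (l x - conj_fn l x) \<and>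
     op_delta \<kappa> \<tau> l x
       = op_Y l (cfn \<tau>) x + 2 * of_real (vc x) * l x - of_real \<kappa> * (l x)\<^sup>2 \<and>
     op_delta \<kappa> \<tau> (conj_fn l) x
       = op_Ybar l (cfn \<tau>) x + 2 * of_real (vc x) * conj_fn l x - of_real \<kappa> * (conj_fn l x)\<^sup>2 \<and>
     of_real (F x) * (op_Y l (conj_fn l) x + op_Ybar l l x)
       = - of_real (vc x * rc x + \<tau> x) * (l x + conj_fn l x)
         + 2 * of_real \<kappa> * (op_delta \<kappa> \<tau> (cfn \<tau>) x
             + of_real (2 * F x + 4 * vc x * \<tau> x + \<kappa> * (rc x)\<^sup>2 + 2 * (vc x)\<^sup>2 * rc x)))"

end

theory Submission
  imports Defs
begin

text \<open>All three operators are vector fields on the space of invariants, so each commutator is a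
  vector field as well, and the commutation relations hold iff they hold on the coordinates \<open>v\<close>
  and \<open>\<rho>\<close>. The \<open>v\<close>-components of \<open>[\<delta>,Y]\<close>, \<open>[\<delta>,Ybar]\<close> give the equation for \<open>\<delta>(F)\<close>; the
  \<open>\<rho>\<close>-components give the equations for \<open>\<delta>(\<lambda>)\<close>, its conjugate, and \<open>Y(\<lambda>bar) - Ybar(\<lambda>)\<close>.

  By the relations the structure functions \<open>\<alpha>, \<alpha>'\<close> of \<open>[\<delta>,Y]\<close>, \<open>[\<delta>,Ybar]\<close> equal
  \<open>2 v - \<kappa> \<lambda>\<close> and \<open>2 v - \<kappa> \<lambda>bar\<close>; let \<open>\<gamma> = (v \<rho> + \<tau>) / F\<close>. The Jacobi sum is
  \<open>J Y + J' Ybar\<close> with \<open>J = \<delta>(\<gamma>) - \<alpha>' \<gamma> + Ybar(\<alpha>)\<close> and \<open>J' = \<alpha> \<gamma> - \<delta>(\<gamma>) - Y(\<alpha>')\<close>.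
  The relations imply \<open>J' = -J\<close>, and \<open>2 F J\<close> is \<open>-\<kappa>\<close> times the difference of the two sides of the
  last equation of the system. For the operators themselves the Jacobi identity is automatic;
  evaluated on \<open>\<rho>\<close> it reads \<open>J (\<lambda> - \<lambda>bar) = 0\<close>, so \<open>J\<close> vanishes wherever
  \<open>\<lambda>\<close> is not real and, if such points are dense, by continuity everywhere.\<close>

section \<open>Iterated directional derivatives\<close>

\<comment> \<open>Otherwise the simplifier splits the direction quantified in \<open>Ck_on\<close> into coordinates.\<close>
declare split_paired_All [simp del]

abbreviation dird :: "pt \<Rightarrow> (pt \<Rightarrow> 'b::real_normed_vector) \<Rightarrow> pt \<Rightarrow> 'b" where
  "dird e f \<equiv> \<lambda>x. frechet_derivative f (at x) e"

lemma dird_eqI: "(f has_derivative f') (at x) \<Longrightarrow> dird e f x = f' e"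
  by (simp add: frechet_derivative_at[symmetric])

text \<open>Where differentiability fails, \<open>frechet_derivative\<close> is a choice among no
  candidates, hence the same for \<open>f\<close> and \<open>g\<close>; so agreement on a
  neighbourhood suffices in every case.\<close>

lemma dird_cong_open:
  assumes "open U" "x \<in> U" "\<And>y. y \<in> U \<Longrightarrow> f y = g y"
  shows "dird e f x = dird e g x"
proof (cases "f differentiable at x")
  case True
  then show ?thesis
    using frechet_derivative_transform_within_open[OF _ assms(1,2)] assms(3) by metis
next
  case False
  then have "\<not> g differentiable at x"
    using has_derivative_transform_within_open[OF _ assms(1,2)] assms(3)
    unfolding differentiable_def by metis
  with False show ?thesis
    unfolding differentiable_def frechet_derivative_def by simp
qed

lemma differentiable_cong_open:
  assumes "open U" "x \<in> U" "\<And>y. y \<in> U \<Longrightarrow> f y = g y" "f differentiable at x"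
  shows "g differentiable at x"
  using has_derivative_transform_within_open[OF _ assms(1,2)] assms(3,4)
  unfolding differentiable_def by metis

text \<open>Sum, product and composition rules give the derivative only at points of
  \<open>U\<close>. This lemma carries \<open>Ck_on\<close> from the expression known there to the
  derivative itself in the inductions below.\<close>

lemma Ck_on_cong:
  assumes "open U" "\<And>y. y \<in> U \<Longrightarrow> f y = g y" "Ck_on k U f"
  shows "Ck_on k U g"
  using assms(2,3)
proof (induction k arbitrary: f g)
  case 0
  then show ?case by (simp cong: continuous_on_cong)
next
  case (Suc k)
  have "g differentiable_on U"
    using Suc.prems assms(1) differentiable_cong_open[of U _ f g]
    by (simp add: differentiable_on_eq_differentiable_at)
  moreover have "Ck_on k U (dird e g)" for e
    by (rule Suc.IH[of "dird e f"])
       (use Suc.prems assms(1) dird_cong_open[of U _ f g] in auto)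
  ultimately show ?case by simp
qed

lemma Ck_on_SucD: "Ck_on (Suc k) U f \<Longrightarrow> Ck_on k U f"
proof (induction k arbitrary: f)
  case 0
  then show ?case by (simp add: differentiable_imp_continuous_on)
next
  case (Suc k)
  then show ?case by (metis Ck_on.simps(2))
qed

lemma Ck_on_mono: "Ck_on m U f \<Longrightarrow> k \<le> m \<Longrightarrow> Ck_on k U f"
proof (induction m)
  case (Suc m)
  then show ?case using Ck_on_SucD[OF Suc.prems(1)] by (cases "k = Suc m") auto
qed simp

lemma Ck_on_differentiable: "Ck_on k U f \<Longrightarrow> open U \<Longrightarrow> x \<in> U \<Longrightarrow> 0 < k \<Longrightarrow> f differentiable at x"
  by (cases k) (simp_all add: differentiable_on_eq_differentiable_at)

lemma Ck_on_dird: "Ck_on (Suc k) U f \<Longrightarrow> Ck_on k U (dird e f)"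
  by simp

section \<open>Stability of the class C^k under linear maps, sums and products\<close>

lemma Ck_on_const: "Ck_on k U (\<lambda>x. c)"
  by (induction k arbitrary: c) simp_all

lemma Ck_on_bounded_linear:
  assumes "bounded_linear T"
  shows "Ck_on k U T"
proof (cases k)
  case 0
  then show ?thesis using assms by (simp add: linear_continuous_on)
next
  case (Suc m)
  have "T differentiable_on U"
    using bounded_linear_imp_has_derivative[OF assms]
    unfolding differentiable_on_def differentiable_def by blast
  moreover have "dird e T = (\<lambda>x. T e)" for e
    using dird_eqI[OF bounded_linear_imp_has_derivative[OF assms]] by blast
  ultimately show ?thesis using Suc by (simp add: Ck_on_const)
qed

lemma dird_bounded_linear_compose:
  assumes "bounded_linear T" "f differentiable at x"
  shows "dird e (\<lambda>y. T (f y)) x = T (dird e f x)"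
  using bounded_linear.has_derivative[OF assms(1) assms(2)[unfolded frechet_derivative_works]]
  by (rule dird_eqI)

lemma Ck_on_bounded_linear_compose:
  assumes "open U" "bounded_linear T" "Ck_on k U f"
  shows "Ck_on k U (\<lambda>x. T (f x))"
  using assms(3)
proof (induction k arbitrary: f)
  case 0
  then show ?case using bounded_linear.continuous_on[OF assms(2)] by simp
next
  case (Suc k)
  have diff: "f differentiable at x" if "x \<in> U" for x
    using Ck_on_differentiable Suc.prems assms(1) that by blast
  have "(\<lambda>x. T (f x)) differentiable_on U"
    unfolding differentiable_on_eq_differentiable_at[OF assms(1)] differentiable_def
    using bounded_linear.has_derivative[OF assms(2) diff[unfolded frechet_derivative_works]] by metis
  moreover have "Ck_on k U (dird e (\<lambda>x. T (f x)))" for e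
    by (rule Ck_on_cong[OF assms(1) _ Suc.IH[of "dird e f"]])
       (use Suc.prems diff in \<open>simp_all add: dird_bounded_linear_compose[OF assms(2)]\<close>)
  ultimately show ?case by simp
qed

lemma dird_add:
  assumes "f differentiable at x" "g differentiable at x"
  shows "dird e (\<lambda>y. f y + g y) x = dird e f x + dird e g x"
  by (rule dird_eqI[OF has_derivative_add]) (use assms frechet_derivative_works in blast)+

lemma dird_mult:
  fixes f g :: "pt \<Rightarrow> 'b::real_normed_algebra"
  assumes "f differentiable at x" "g differentiable at x"
  shows "dird e (\<lambda>y. f y * g y) x = f x * dird e g x + dird e f x * g x"
  by (rule dird_eqI[OF has_derivative_mult]) (use assms frechet_derivative_works in blast)+

lemma Ck_on_add:
  assumes "open U" "Ck_on k U f" "Ck_on k U g"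
  shows "Ck_on k U (\<lambda>x. f x + g x)"
  using assms(2,3)
proof (induction k arbitrary: f g)
  case 0
  then show ?case by (simp add: continuous_on_add)
next
  case (Suc k)
  have diff: "f differentiable at x" "g differentiable at x" if "x \<in> U" for x
    using Ck_on_differentiable Suc.prems assms(1) that by blast+
  have "(\<lambda>x. f x + g x) differentiable_on U"
    using Suc.prems by simp
  moreover have "Ck_on k U (dird e (\<lambda>x. f x + g x))" for e
    by (rule Ck_on_cong[OF assms(1) _ Suc.IH[of "dird e f" "dird e g"]])
       (use Suc.prems diff in \<open>simp_all add: dird_add\<close>)
  ultimately show ?case by simp
qed

lemma Ck_on_mult:
  fixes f g :: "pt \<Rightarrow> 'b::real_normed_algebra"
  assumes "open U" "Ck_on k U f" "Ck_on k U g"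
  shows "Ck_on k U (\<lambda>x. f x * g x)"
  using assms(2,3)
proof (induction k arbitrary: f g)
  case 0
  then show ?case by (simp add: continuous_on_mult)
next
  case (Suc k)
  have diff: "f differentiable at x" "g differentiable at x" if "x \<in> U" for x
    using Ck_on_differentiable Suc.prems assms(1) that by blast+
  have "(\<lambda>x. f x * g x) differentiable_on U"
    using Suc.prems assms(1) diff
    by (auto simp: differentiable_on_eq_differentiable_at intro: differentiable_mult)
  moreover have "Ck_on k U (dird e (\<lambda>x. f x * g x))" for e
  proof (rule Ck_on_cong[OF assms(1)])
    \<comment> \<open>Each summand pairs a first derivative with an undifferentiated factor lowered
      to C^k, so the induction hypothesis is needed for arbitrary pairs.\<close>
    show "Ck_on k U (\<lambda>x. f x * dird e g x + dird e f x * g x)"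
      by (intro Ck_on_add Suc.IH assms(1) Ck_on_dird Ck_on_SucD[OF Suc.prems(1)]
            Ck_on_SucD[OF Suc.prems(2)] Suc.prems)
  qed (use diff in \<open>simp add: dird_mult\<close>)
  ultimately show ?case by simp
qed

lemma Ck_on_diff:
  assumes "open U" "Ck_on k U f" "Ck_on k U g"
  shows "Ck_on k U (\<lambda>x. f x - g x)"
  using Ck_on_add[OF assms(1,2)
      Ck_on_bounded_linear_compose[OF assms(1) bounded_linear_minus[OF bounded_linear_ident] assms(3)]]
  by simp

section \<open>Symmetry of mixed second derivatives\<close>

lemma has_real_derivative_along_line:
  fixes f :: "pt \<Rightarrow> real"
  assumes "f differentiable at (x + s *\<^sub>R a)"
  shows "((\<lambda>s. f (x + s *\<^sub>R a)) has_real_derivative dird a f (x + s *\<^sub>R a)) (at s)"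
proof -
  let ?f' = "frechet_derivative f (at (x + s *\<^sub>R a))"
  have "((\<lambda>s. f (x + s *\<^sub>R a)) has_derivative (\<lambda>r. ?f' (r *\<^sub>R a))) (at s)"
    by (rule has_derivative_compose[where f = "\<lambda>s. x + s *\<^sub>R a"])
       (use assms[unfolded frechet_derivative_works] in \<open>auto intro!: derivative_eq_intros\<close>)
  moreover have "?f' (r *\<^sub>R a) = dird a f (x + s *\<^sub>R a) * r" for r
    using linear_frechet_derivative[OF assms] by (simp add: linear_cmul)
  ultimately show ?thesis by (simp add: has_field_derivative_def)
qed

text \<open>The mean value theorem is applied twice: in direction \<open>a\<close> to the increment
  of \<open>f\<close> across \<open>h *\<^sub>R b\<close>, then in direction \<open>b\<close> to
  \<open>dird a f\<close>. The second difference itself is symmetric in \<open>a\<close> and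
  \<open>b\<close>.\<close>

lemma second_difference_mean_value:
  fixes f :: "pt \<Rightarrow> real"
  assumes "0 < h"
    and f: "\<And>s t. s \<in> {0..h} \<Longrightarrow> t \<in> {0..h} \<Longrightarrow> f differentiable at (x + s *\<^sub>R a + t *\<^sub>R b)"
    and f': "\<And>s t. s \<in> {0..h} \<Longrightarrow> t \<in> {0..h} \<Longrightarrow> dird a f differentiable at (x + s *\<^sub>R a + t *\<^sub>R b)"
  shows "\<exists>s\<in>{0..h}. \<exists>t\<in>{0..h}.
    f (x + h *\<^sub>R a + h *\<^sub>R b) - f (x + h *\<^sub>R a) - f (x + h *\<^sub>R b) + f x
      = h * h * dird b (dird a f) (x + s *\<^sub>R a + t *\<^sub>R b)"
proof -
  have "((\<lambda>s. f (x + h *\<^sub>R b + s *\<^sub>R a) - f (x + s *\<^sub>R a)) has_real_derivative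
      dird a f (x + h *\<^sub>R b + s *\<^sub>R a) - dird a f (x + s *\<^sub>R a)) (at s)" if "0 \<le> s" "s \<le> h" for s
    by (intro DERIV_diff has_real_derivative_along_line)
       (use f[of s h] f[of s 0] that \<open>0 < h\<close> in \<open>simp_all add: algebra_simps\<close>)
  from MVT2[OF \<open>0 < h\<close> this] obtain s where s: "0 < s" "s < h" and
    eq1: "(f (x + h *\<^sub>R b + h *\<^sub>R a) - f (x + h *\<^sub>R a)) - (f (x + h *\<^sub>R b) - f x)
      = h * (dird a f (x + h *\<^sub>R b + s *\<^sub>R a) - dird a f (x + s *\<^sub>R a))"
    by auto
  have "((\<lambda>t. dird a f (x + s *\<^sub>R a + t *\<^sub>R b)) has_real_derivative
      dird b (dird a f) (x + s *\<^sub>R a + t *\<^sub>R b)) (at t)" if "0 \<le> t" "t \<le> h" for t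
    by (intro has_real_derivative_along_line) (use f'[of s t] that s in simp)
  from MVT2[OF \<open>0 < h\<close> this] obtain t where t: "0 < t" "t < h" and
    eq2: "dird a f (x + s *\<^sub>R a + h *\<^sub>R b) - dird a f (x + s *\<^sub>R a)
      = h * dird b (dird a f) (x + s *\<^sub>R a + t *\<^sub>R b)"
    by auto
  have "f (x + h *\<^sub>R a + h *\<^sub>R b) - f (x + h *\<^sub>R a) - f (x + h *\<^sub>R b) + f x
      = h * h * dird b (dird a f) (x + s *\<^sub>R a + t *\<^sub>R b)"
    using eq1 eq2 by (simp add: algebra_simps)
  then show ?thesis using s t by (meson atLeastAtMost_iff less_imp_le)
qed

text \<open>Schwarz's theorem: one symmetric second difference equals \<open>h * h\<close> times
  either mixed derivative at some point close to \<open>x\<close>, and both mixed derivatives are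
  continuous.\<close>

lemma dird_commute_real:
  fixes f :: "pt \<Rightarrow> real"
  assumes "open U" "x \<in> U" "Ck_on 2 U f"
  shows "dird a (dird b f) x = dird b (dird a f) x"
proof (rule ccontr)
  let ?A = "dird b (dird a f)" and ?B = "dird a (dird b f)"
  assume ne: "?B x \<noteq> ?A x"
  \<comment> \<open>Half the supposed gap: two errors below \<open>\<epsilon>\<close> cannot add up
    to it.\<close>
  define \<epsilon> where "\<epsilon> = \<bar>?B x - ?A x\<bar> / 2"
  have "\<epsilon> > 0" using ne by (simp add: \<epsilon>_def)
  have C2: "Ck_on (Suc (Suc 0)) U f" using assms(3) by (simp add: numeral_2_eq_2)
  then have "continuous_on U ?A" "continuous_on U ?B" by simp_all
  then have "isCont ?A x" "isCont ?B x"
    using assms(1,2) continuous_on_eq_continuous_at by blast+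
  note cont = this[unfolded continuous_at_eps_delta]
  obtain d1 where d1: "d1 > 0" "\<And>y. dist y x < d1 \<Longrightarrow> dist (?A y) (?A x) < \<epsilon>"
    using cont(1) \<open>\<epsilon> > 0\<close> by blast
  obtain d2 where d2: "d2 > 0" "\<And>y. dist y x < d2 \<Longrightarrow> dist (?B y) (?B x) < \<epsilon>"
    using cont(2) \<open>\<epsilon> > 0\<close> by blast
  obtain d3 where d3: "d3 > 0" "ball x d3 \<subseteq> U" using assms(1,2) openE by blast
  define r where "r = Min {d1, d2, d3}"
  have r: "r > 0" "r \<le> d1" "r \<le> d2" "r \<le> d3" using d1(1) d2(1) d3(1) by (simp_all add: r_def)
  \<comment> \<open>This step size keeps the whole parallelogram within distance \<open>r\<close> of
    \<open>x\<close>; the summand 1 keeps the denominator positive when \<open>a\<close> and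
    \<open>b\<close> vanish.\<close>
  define h where "h = r / (norm a + norm b + 1)"
  have pos: "norm a + norm b + 1 > 0" using norm_ge_zero[of a] norm_ge_zero[of b] by linarith
  then have "h > 0" using r by (simp add: h_def)
  have near: "dist (x + s *\<^sub>R a + t *\<^sub>R b) x < r" if "s \<in> {0..h}" "t \<in> {0..h}" for s t
  proof -
    have "dist (x + s *\<^sub>R a + t *\<^sub>R b) x \<le> s * norm a + t * norm b"
      using norm_triangle_ineq[of "s *\<^sub>R a" "t *\<^sub>R b"] that by (simp add: dist_norm add.assoc)
    also have "\<dots> \<le> h * norm a + h * norm b"
      using that by (intro add_mono mult_right_mono) auto
    also have "\<dots> < h * (norm a + norm b + 1)" using \<open>h > 0\<close> by (simp add: algebra_simps)
    also have "\<dots> = r" using pos by (simp add: h_def)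
    finally show ?thesis .
  qed
  have inU: "x + s *\<^sub>R a + t *\<^sub>R b \<in> U" if "s \<in> {0..h}" "t \<in> {0..h}" for s t
    using near[OF that] r(4) d3(2) by (simp add: subset_iff dist_commute)
  have diff: "f differentiable at y" "dird e f differentiable at y" if "y \<in> U" for e y
    using C2 that assms(1) by (simp_all add: differentiable_on_eq_differentiable_at)
  obtain s t where st: "s \<in> {0..h}" "t \<in> {0..h}" and
    eqA: "f (x + h *\<^sub>R a + h *\<^sub>R b) - f (x + h *\<^sub>R a) - f (x + h *\<^sub>R b) + f x
      = h * h * ?A (x + s *\<^sub>R a + t *\<^sub>R b)"
    using second_difference_mean_value[OF \<open>h > 0\<close> diff(1)[OF inU] diff(2)[OF inU]] by blast
  \<comment> \<open>The same parallelogram with the roles of \<open>a\<close> and \<open>b\<close>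
    exchanged, for the other mixed derivative.\<close>
  have inU': "x + t *\<^sub>R b + s *\<^sub>R a \<in> U" if "t \<in> {0..h}" "s \<in> {0..h}" for s t
    using inU[OF that(2,1)] by (simp add: algebra_simps)
  obtain t' s' where st': "s' \<in> {0..h}" "t' \<in> {0..h}" and
    eqB: "f (x + h *\<^sub>R b + h *\<^sub>R a) - f (x + h *\<^sub>R b) - f (x + h *\<^sub>R a) + f x
      = h * h * ?B (x + t' *\<^sub>R b + s' *\<^sub>R a)"
    using second_difference_mean_value[OF \<open>h > 0\<close> diff(1)[OF inU'] diff(2)[OF inU']] by blast
  have "h * h * ?A (x + s *\<^sub>R a + t *\<^sub>R b) = h * h * ?B (x + s' *\<^sub>R a + t' *\<^sub>R b)"
    using eqA eqB by (simp add: algebra_simps)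
  then have "?A (x + s *\<^sub>R a + t *\<^sub>R b) = ?B (x + s' *\<^sub>R a + t' *\<^sub>R b)" using \<open>h > 0\<close> by simp
  moreover have "dist (?A (x + s *\<^sub>R a + t *\<^sub>R b)) (?A x) < \<epsilon>"
    using d1(2) near[OF st] r(2) by simp
  moreover have "dist (?B (x + s' *\<^sub>R a + t' *\<^sub>R b)) (?B x) < \<epsilon>"
    using d2(2) near[OF st'] r(3) by simp
  ultimately have "\<bar>?B x - ?A x\<bar> < 2 * \<epsilon>" by (simp add: dist_real_def)
  then show False by (simp add: \<epsilon>_def)
qed

text \<open>The mean value theorem is a statement about real functions, so symmetry is transferred
  through the real and imaginary parts, which are bounded linear and commute with
  \<open>dird\<close>.\<close>

lemma dird_commute:
  fixes f :: fn
  assumes "open U" "x \<in> U" "Ck_on 2 U f"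
  shows "dird a (dird b f) x = dird b (dird a f) x"
proof -
  have C2: "Ck_on (Suc (Suc 0)) U f" using assms(3) by (simp add: numeral_2_eq_2)
  have diff: "f differentiable at y" "dird e f differentiable at y" if "y \<in> U" for e y
    using C2 that assms(1) by (simp_all add: differentiable_on_eq_differentiable_at)
  have T: "T (dird a (dird b f) x) = dird a (dird b (\<lambda>y. T (f y))) x"
    if "bounded_linear T" for a b and T :: "complex \<Rightarrow> real"
  proof -
    have "T (dird a (dird b f) x) = dird a (\<lambda>y. T (dird b f y)) x"
      using dird_bounded_linear_compose[OF that diff(2)[OF assms(2)]] by simp
    also have "\<dots> = dird a (dird b (\<lambda>y. T (f y))) x"
      by (rule dird_cong_open[OF assms(1,2)])
         (simp add: dird_bounded_linear_compose[OF that diff(1)])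
    finally show ?thesis .
  qed
  have "T (dird a (dird b f) x) = T (dird b (dird a f) x)"
    if "bounded_linear T" for T :: "complex \<Rightarrow> real"
    using dird_commute_real[OF assms(1,2) Ck_on_bounded_linear_compose[OF assms(1) that assms(3)]]
    by (simp add: T[OF that])
  from this[OF bounded_linear_Re] this[OF bounded_linear_Im] show ?thesis
    by (simp add: complex_eq_iff)
qed

section \<open>First-order differential operators\<close>

text \<open>A general vector field with complex coefficients. All three operators are instances, so
  commutators and the Jacobi identity are computed once.\<close>

definition vfield :: "fn \<Rightarrow> fn \<Rightarrow> fn \<Rightarrow> fn \<Rightarrow> fn" where
  "vfield a b c f = (\<lambda>x. a x * Dt f x + b x * Dv f x + c x * Dr f x)"

lemma op_delta_eq_vfield:
  "op_delta \<kappa> \<tau> = vfield (\<lambda>x. 1) (\<lambda>x. of_real (\<kappa> * rc x - (vc x)\<^sup>2)) (cfn \<tau>)"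
  by (simp add: fun_eq_iff op_delta_def vfield_def cfn_def)

lemma op_Y_eq_vfield: "op_Y l = vfield (\<lambda>x. 0) (\<lambda>x. 1) l"
  by (simp add: fun_eq_iff op_Y_def vfield_def)

lemma op_Ybar_eq_op_Y: "op_Ybar l = op_Y (conj_fn l)"
  by (simp add: fun_eq_iff op_Y_def op_Ybar_def)

lemmas op_eq_vfield = op_delta_eq_vfield op_Ybar_eq_op_Y op_Y_eq_vfield

lemma Ck_on_partials:
  assumes "Ck_on (Suc k) U f"
  shows "Ck_on k U (Dt f)" "Ck_on k U (Dv f)" "Ck_on k U (Dr f)"
  using Ck_on_dird[OF assms] by (simp_all add: Dt_def[abs_def] Dv_def[abs_def] Dr_def[abs_def])

lemma Ck_on_vfield:
  assumes "open U" "Ck_on k U a" "Ck_on k U b" "Ck_on k U c" "Ck_on (Suc k) U f"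
  shows "Ck_on k U (vfield a b c f)"
  unfolding vfield_def
  by (intro Ck_on_add Ck_on_mult Ck_on_partials assms)

lemma vfield_cong_open:
  assumes "open U" "x \<in> U" "\<And>y. y \<in> U \<Longrightarrow> f y = g y"
  shows "vfield a b c f x = vfield a b c g x"
  using dird_cong_open[OF assms(1,2), of f g] assms(3) by (simp add: vfield_def Dt_def Dv_def Dr_def)

lemma vfield_add:
  assumes "f differentiable at x" "g differentiable at x"
  shows "vfield a b c (\<lambda>y. f y + g y) x = vfield a b c f x + vfield a b c g x"
  by (simp add: vfield_def Dt_def Dv_def Dr_def dird_add[OF assms] algebra_simps)

lemma vfield_mult:
  assumes "f differentiable at x" "g differentiable at x"
  shows "vfield a b c (\<lambda>y. f y * g y) x = vfield a b c f x * g x + f x * vfield a b c g x"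
  by (simp add: vfield_def Dt_def Dv_def Dr_def dird_mult[OF assms] algebra_simps)

lemma vfield_const [simp]: "vfield a b c (\<lambda>y. k) x = 0"
  by (simp add: vfield_def Dt_def Dv_def Dr_def)

lemma vfield_cmult:
  assumes "f differentiable at x"
  shows "vfield a b c (\<lambda>y. k * f y) x = k * vfield a b c f x"
  using vfield_mult[OF differentiable_const assms, of a b c k] by simp

lemma vfield_diff:
  assumes "f differentiable at x" "g differentiable at x"
  shows "vfield a b c (\<lambda>y. f y - g y) x = vfield a b c f x - vfield a b c g x"
  using vfield_add[of f x "\<lambda>y. - 1 * g y" a b c] vfield_cmult[OF assms(2), of a b c "-1"] assms
  by simp

lemma vfield_minus:
  assumes "f differentiable at x"
  shows "vfield a b c (\<lambda>y. - f y) x = - vfield a b c f x"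
  using vfield_cmult[OF assms, of a b c "-1"] by simp

section \<open>Commutators and the Jacobi identity for vector fields\<close>

lemma dird_vfield:
  assumes "a differentiable at x" "b differentiable at x" "c differentiable at x"
    and "Dt f differentiable at x" "Dv f differentiable at x" "Dr f differentiable at x"
  shows "dird e (vfield a b c f) x =
    dird e a x * Dt f x + a x * dird e (Dt f) x + dird e b x * Dv f x + b x * dird e (Dv f) x
      + dird e c x * Dr f x + c x * dird e (Dr f) x"
  unfolding vfield_def
  using assms by (simp add: dird_add dird_mult)

text \<open>The second-order terms cancel by symmetry of the second partial derivatives of
  \<open>f\<close>; what remains differentiates the coefficients once.\<close>

lemma vfield_commutator:
  assumes "open U" "x \<in> U" "Ck_on 2 U f"
    and "a differentiable at x" "b differentiable at x" "c differentiable at x"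
    and "a' differentiable at x" "b' differentiable at x" "c' differentiable at x"
  shows "commut (vfield a b c) (vfield a' b' c') f x =
      (vfield a b c a' x - vfield a' b' c' a x) * Dt f x
    + (vfield a b c b' x - vfield a' b' c' b x) * Dv f x
    + (vfield a b c c' x - vfield a' b' c' c x) * Dr f x"
proof -
  have "Ck_on 1 U (Dt f)" "Ck_on 1 U (Dv f)" "Ck_on 1 U (Dr f)"
    using Ck_on_partials[of 1 U f] assms(3) by (simp_all add: numeral_2_eq_2)
  then have "Dt f differentiable at x" "Dv f differentiable at x" "Dr f differentiable at x"
    using Ck_on_differentiable assms(1,2) zero_less_one by blast+
  note [simp] = dird_vfield[OF assms(4-6) this] dird_vfield[OF assms(7-9) this]
  have comm: "Dv (Dt f) x = Dt (Dv f) x" "Dr (Dt f) x = Dt (Dr f) x" "Dr (Dv f) x = Dv (Dr f) x"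
    using dird_commute[OF assms(1-3)] by (simp_all add: Dt_def[abs_def] Dv_def[abs_def] Dr_def[abs_def])
  have "commut (vfield a b c) (vfield a' b' c') f x =
    a x * Dt (vfield a' b' c' f) x + b x * Dv (vfield a' b' c' f) x + c x * Dr (vfield a' b' c' f) x
    - (a' x * Dt (vfield a b c f) x + b' x * Dv (vfield a b c f) x + c' x * Dr (vfield a b c f) x)"
    by (simp add: commut_def vfield_def)
  moreover have "Dt (vfield a b c f) x = Dt a x * Dt f x + a x * Dt (Dt f) x + Dt b x * Dv f x
      + b x * Dt (Dv f) x + Dt c x * Dr f x + c x * Dt (Dr f) x"
    "Dv (vfield a b c f) x = Dv a x * Dt f x + a x * Dv (Dt f) x + Dv b x * Dv f x
      + b x * Dv (Dv f) x + Dv c x * Dr f x + c x * Dv (Dr f) x"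
    "Dr (vfield a b c f) x = Dr a x * Dt f x + a x * Dr (Dt f) x + Dr b x * Dv f x
      + b x * Dr (Dv f) x + Dr c x * Dr f x + c x * Dr (Dr f) x"
    "Dt (vfield a' b' c' f) x = Dt a' x * Dt f x + a' x * Dt (Dt f) x + Dt b' x * Dv f x
      + b' x * Dt (Dv f) x + Dt c' x * Dr f x + c' x * Dt (Dr f) x"
    "Dv (vfield a' b' c' f) x = Dv a' x * Dt f x + a' x * Dv (Dt f) x + Dv b' x * Dv f x
      + b' x * Dv (Dv f) x + Dv c' x * Dr f x + c' x * Dv (Dr f) x"
    "Dr (vfield a' b' c' f) x = Dr a' x * Dt f x + a' x * Dr (Dt f) x + Dr b' x * Dv f x
      + b' x * Dr (Dv f) x + Dr c' x * Dr f x + c' x * Dr (Dr f) x"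
    by (simp_all add: Dt_def[of "vfield a b c f"] Dv_def[of "vfield a b c f"] Dr_def[of "vfield a b c f"]
        Dt_def[of "vfield a' b' c' f"] Dv_def[of "vfield a' b' c' f"] Dr_def[of "vfield a' b' c' f"])
       (simp_all add: Dt_def Dv_def Dr_def)
  ultimately show ?thesis
    unfolding vfield_def comm by (simp only:) (simp only: algebra_simps)
qed

text \<open>The twelve triple compositions cancel in pairs. Splitting an outer operator over an
  inner commutator requires the twofold compositions to be differentiable, which the orders 3 for
  \<open>f\<close> and 2 for the coefficients guarantee.\<close>

lemma vfield_jacobi:
  fixes a1 b1 c1 a2 b2 c2 a3 b3 c3 :: fn
  defines "P \<equiv> vfield a1 b1 c1" and "Q \<equiv> vfield a2 b2 c2" and "R \<equiv> vfield a3 b3 c3"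
  assumes "open U" "x \<in> U" "Ck_on 3 U f"
    and "Ck_on 2 U a1" "Ck_on 2 U b1" "Ck_on 2 U c1"
    and "Ck_on 2 U a2" "Ck_on 2 U b2" "Ck_on 2 U c2"
    and "Ck_on 2 U a3" "Ck_on 2 U b3" "Ck_on 2 U c3"
  shows "commut P (commut Q R) f x + commut Q (commut R P) f x + commut R (commut P Q) f x = 0"
proof -
  have C2: "Ck_on 2 U (P f)" "Ck_on 2 U (Q f)" "Ck_on 2 U (R f)"
    unfolding P_def Q_def R_def using assms(4-15)
    by (auto intro!: Ck_on_vfield simp: eval_nat_numeral simp del: Ck_on.simps)
  have diff: "(vfield a b c g) differentiable at x"
    if "Ck_on 2 U a" "Ck_on 2 U b" "Ck_on 2 U c" "Ck_on 2 U g" for a b c g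
    by (rule Ck_on_differentiable[where k = 1 and U = U], rule Ck_on_vfield)
       (use that assms(4,5) in \<open>auto intro: Ck_on_SucD simp: eval_nat_numeral simp del: Ck_on.simps\<close>)
  have d: "P (Q f) differentiable at x" "P (R f) differentiable at x"
    "Q (P f) differentiable at x" "Q (R f) differentiable at x"
    "R (P f) differentiable at x" "R (Q f) differentiable at x"
    using assms(7-) C2 unfolding P_def Q_def R_def by (auto intro!: diff)
  show ?thesis
    using d unfolding commut_def
    by (simp add: P_def Q_def R_def vfield_diff)
qed

section \<open>Coordinate functions and coefficients of the operators\<close>

lemma Ck_on_cfn:
  assumes "open U" "Ck_on k U g"
  shows "Ck_on k U (cfn g)"
  unfolding cfn_def by (rule Ck_on_bounded_linear_compose[OF assms(1) bounded_linear_of_real assms(2)])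

lemma Ck_on_conj_fn:
  assumes "open U" "Ck_on k U f"
  shows "Ck_on k U (conj_fn f)"
  unfolding conj_fn_def by (rule Ck_on_bounded_linear_compose[OF assms(1) bounded_linear_cnj assms(2)])

lemma bounded_linear_vc: "bounded_linear (\<lambda>x::pt. complex_of_real (vc x))"
  and bounded_linear_rc: "bounded_linear (\<lambda>x::pt. complex_of_real (rc x))"
  by (intro bounded_linear_compose[OF bounded_linear_of_real]
      bounded_linear_compose[OF bounded_linear_fst] bounded_linear_compose[OF bounded_linear_snd]
      bounded_linear_ident bounded_linear_snd)+

lemmas Ck_on_vc = Ck_on_bounded_linear[OF bounded_linear_vc]
lemmas Ck_on_rc = Ck_on_bounded_linear[OF bounded_linear_rc]

lemma Ck_on_flow_coeff:
  assumes "open U"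
  shows "Ck_on k U (\<lambda>x. complex_of_real (\<kappa> * rc x - (vc x)\<^sup>2))"
  using assms
  by (simp add: power2_eq_square) (intro Ck_on_diff Ck_on_mult Ck_on_const Ck_on_vc Ck_on_rc)

lemma differentiable_vc: "(\<lambda>x::pt. complex_of_real (vc x)) differentiable at x"
  and differentiable_rc: "(\<lambda>x::pt. complex_of_real (rc x)) differentiable at x"
  using Ck_on_differentiable[OF Ck_on_vc, of UNIV x 1] Ck_on_differentiable[OF Ck_on_rc, of UNIV x 1]
  by auto

lemma differentiable_flow_coeff: "(\<lambda>x::pt. complex_of_real (\<kappa> * rc x - (vc x)\<^sup>2)) differentiable at x"
  using Ck_on_differentiable[OF Ck_on_flow_coeff[of UNIV], of x 1] by auto

lemma partials_vc: "Dt (\<lambda>x. of_real (vc x)) x = 0" "Dv (\<lambda>x. of_real (vc x)) x = 1"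
    "Dr (\<lambda>x. of_real (vc x)) x = 0"
  using dird_eqI[OF bounded_linear_imp_has_derivative[OF bounded_linear_vc]]
  by (simp_all add: Dt_def Dv_def Dr_def)

lemma partials_rc: "Dt (\<lambda>x. of_real (rc x)) x = 0" "Dv (\<lambda>x. of_real (rc x)) x = 0"
    "Dr (\<lambda>x. of_real (rc x)) x = 1"
  using dird_eqI[OF bounded_linear_imp_has_derivative[OF bounded_linear_rc]]
  by (simp_all add: Dt_def Dv_def Dr_def)

lemma vfield_vc [simp]: "vfield a b c (\<lambda>x. of_real (vc x)) x = b x"
  by (simp add: vfield_def partials_vc)

lemma vfield_rc [simp]: "vfield a b c (\<lambda>x. of_real (rc x)) x = c x"
  by (simp add: vfield_def partials_rc)

lemma vfield_flow_coeff:
  "vfield a b c (\<lambda>x. complex_of_real (\<kappa> * rc x - (vc x)\<^sup>2)) x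
    = of_real \<kappa> * c x - 2 * of_real (vc x) * b x"
proof -
  have "vfield a b c (\<lambda>x. complex_of_real (\<kappa> * rc x - (vc x)\<^sup>2)) x
    = vfield a b c (\<lambda>x. of_real \<kappa> * of_real (rc x) - of_real (vc x) * of_real (vc x)) x"
    by (simp add: power2_eq_square)
  also have "\<dots> = of_real \<kappa> * c x - 2 * of_real (vc x) * b x"
    by (simp add: vfield_diff vfield_mult vfield_cmult differentiable_mult
        differentiable_vc differentiable_rc)
  finally show ?thesis .
qed

text \<open>The t-components of both fields and the v-component of \<open>op_Y l\<close> are
  constant. So the t-component of the commutator vanishes, and its v-component is minus the
  derivative of \<open>\<kappa> * rc x - (vc x)\<^sup>2\<close> along \<open>op_Y l\<close>.\<close>

lemma commut_op_delta_op_Y: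
  assumes "open U" "x \<in> U" "Ck_on 2 U f" "cfn \<tau> differentiable at x" "l differentiable at x"
  shows "commut (op_delta \<kappa> \<tau>) (op_Y l) f x =
      (2 * of_real (vc x) - of_real \<kappa> * l x) * Dv f x
      + (op_delta \<kappa> \<tau> l x - op_Y l (cfn \<tau>) x) * Dr f x"
  unfolding op_eq_vfield
  by (subst vfield_commutator[OF assms(1-3)])
     (use assms(4,5) in \<open>simp_all only: differentiable_const differentiable_flow_coeff
        vfield_const vfield_flow_coeff, simp\<close>)

lemma commut_op_Y_op_Y:
  assumes "open U" "x \<in> U" "Ck_on 2 U f" "l differentiable at x" "m differentiable at x"
  shows "commut (op_Y l) (op_Y m) f x = (op_Y l m x - op_Y m l x) * Dr f x"
  unfolding op_eq_vfield
  by (subst vfield_commutator[OF assms(1-3)]) (use assms(4,5) in simp_all)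

section \<open>The commutator algebra\<close>

text \<open>Two derivatives of \<open>F\<close> are used, since \<open>\<delta> (cfn F)\<close>
  occurs in \<open>\<alpha>\<close> and the Jacobi components differentiate \<open>\<alpha>\<close>.
  Second order for \<open>\<tau>\<close> and \<open>l\<close> gives the coefficient regularity of
  \<open>vfield_jacobi\<close>.\<close>

locale projected_operators =
  fixes U :: "pt set" and \<kappa> :: real and F \<tau> :: "pt \<Rightarrow> real" and l :: fn
  assumes \<kappa>: "\<kappa> \<in> {1, -1}"
    and open_U: "open U"
    and C2_F: "Ck_on 2 U F" and C2_\<tau>: "Ck_on 2 U \<tau>" and C2_l: "Ck_on 2 U l"
    and F_nonzero: "x \<in> U \<Longrightarrow> F x \<noteq> 0"
begin

abbreviation \<delta> where "\<delta> \<equiv> op_delta \<kappa> \<tau>"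
abbreviation Y where "Y \<equiv> op_Y l"
abbreviation Y' where "Y' \<equiv> op_Ybar l"
abbreviation l' where "l' \<equiv> conj_fn l"
abbreviation \<alpha> where "\<alpha> \<equiv> coeff_dY \<kappa> F \<tau> l"
abbreviation \<alpha>' where "\<alpha>' \<equiv> coeff_dYbar \<kappa> F \<tau> l"
abbreviation \<gamma> where "\<gamma> \<equiv> coeff_YYbar F \<tau>"

section \<open>The commutation relations in coordinates\<close>

lemma C2: "Ck_on 2 U (cfn F)" "Ck_on 2 U (cfn \<tau>)" "Ck_on 2 U l'"
  by (intro Ck_on_cfn Ck_on_conj_fn open_U C2_F C2_\<tau> C2_l)+

lemma differentiable:
  assumes "x \<in> U"
  shows "cfn F differentiable at x" "cfn \<tau> differentiable at x"
    "l differentiable at x" "l' differentiable at x"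
  using Ck_on_differentiable[OF _ open_U assms] C2 C2_l zero_less_numeral by blast+

lemma coords_smooth:
  "smooth_fn_on U (\<lambda>x. complex_of_real (vc x))" "smooth_fn_on U (\<lambda>x. complex_of_real (rc x))"
  by (simp_all add: smooth_fn_on_def Ck_on_vc Ck_on_rc)

text \<open>Comparison of components at one point: the first two equations come from the
  v-components, the other three from the \<rho>-components. In the last one, \<open>Y\<close> minus
  \<open>Y'\<close> has only the \<rho>-component \<open>l x - l' x\<close>.\<close>

definition structure_eqs :: "pt \<Rightarrow> bool" where
  "structure_eqs x \<longleftrightarrow>
    \<alpha> x = 2 * of_real (vc x) - of_real \<kappa> * l x \<and>
    \<alpha>' x = 2 * of_real (vc x) - of_real \<kappa> * l' x \<and>
    \<delta> l x - Y (cfn \<tau>) x = \<alpha> x * l x \<and>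
    \<delta> l' x - Y' (cfn \<tau>) x = \<alpha>' x * l' x \<and>
    Y l' x - Y' l x = \<gamma> x * (l x - l' x)"

lemma commut_generators:
  assumes "x \<in> U" "Ck_on 2 U f"
  shows "commut \<delta> Y f x = (2 * of_real (vc x) - of_real \<kappa> * l x) * Dv f x
      + (\<delta> l x - Y (cfn \<tau>) x) * Dr f x"
    and "commut \<delta> Y' f x = (2 * of_real (vc x) - of_real \<kappa> * l' x) * Dv f x
      + (\<delta> l' x - Y' (cfn \<tau>) x) * Dr f x"
    and "commut Y Y' f x = (Y l' x - Y' l x) * Dr f x"
  unfolding op_Ybar_eq_op_Y
  using commut_op_delta_op_Y[OF open_U assms] commut_op_Y_op_Y[OF open_U assms]
    differentiable[OF assms(1)] by blast+

lemma commutation_relations: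
  assumes "structure_eqs x" "x \<in> U" "Ck_on 2 U f"
  shows "commut \<delta> Y f x = \<alpha> x * Y f x"
    and "commut \<delta> Y' f x = \<alpha>' x * Y' f x"
    and "commut Y Y' f x = \<gamma> x * (Y f x - Y' f x)"
proof -
  note eqs = assms(1)[unfolded structure_eqs_def]
  have "commut \<delta> Y f x = \<alpha> x * Dv f x + \<alpha> x * l x * Dr f x"
    unfolding commut_generators(1)[OF assms(2,3)] using eqs by metis
  then show "commut \<delta> Y f x = \<alpha> x * Y f x" by (simp add: op_Y_def algebra_simps)
  have "commut \<delta> Y' f x = \<alpha>' x * Dv f x + \<alpha>' x * l' x * Dr f x"
    unfolding commut_generators(2)[OF assms(2,3)] using eqs by metis
  then show "commut \<delta> Y' f x = \<alpha>' x * Y' f x" by (simp add: op_Ybar_def algebra_simps)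
  have "commut Y Y' f x = \<gamma> x * (l x - l' x) * Dr f x"
    unfolding commut_generators(3)[OF assms(2,3)] using eqs by metis
  then show "commut Y Y' f x = \<gamma> x * (Y f x - Y' f x)"
    by (simp add: op_Y_def op_Ybar_def algebra_simps)
qed

text \<open>The functions v and \<rho> serve as test functions for the forward direction. The
  coordinate t yields no equation, because the t-components vanish on both sides of every
  relation.\<close>

lemma commutator_algebra_iff: "commutator_algebra U \<kappa> F \<tau> l \<longleftrightarrow> (\<forall>x\<in>U. structure_eqs x)"
proof
  assume alg: "commutator_algebra U \<kappa> F \<tau> l"
  show "\<forall>x\<in>U. structure_eqs x"
  proof
    fix x assume x: "x \<in> U"
    note v = alg[unfolded commutator_algebra_def, rule_format, OF coords_smooth(1) x]
    note \<rho> = alg[unfolded commutator_algebra_def, rule_format, OF coords_smooth(2) x]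
    show "structure_eqs x"
      using v \<rho>
      by (simp add: commut_generators[OF x Ck_on_vc] commut_generators[OF x Ck_on_rc]
          partials_vc partials_rc op_Y_def[of _ "\<lambda>x. complex_of_real (_ x)"]
          op_Ybar_def[of _ "\<lambda>x. complex_of_real (_ x)"] structure_eqs_def)
  qed
next
  assume "\<forall>x\<in>U. structure_eqs x"
  then show "commutator_algebra U \<kappa> F \<tau> l"
    unfolding commutator_algebra_def smooth_fn_on_def using commutation_relations by blast
qed

text \<open>The conditions on \<open>\<alpha>\<close> and \<open>\<alpha>'\<close> reduce to the
  same formula for \<open>\<delta> (cfn F) x / of_real (F x)\<close>, symmetric in \<open>l\<close>
  and \<open>l'\<close>; so five structure equations become four.\<close>

lemma structure_eqs_iff:
  assumes "x \<in> U"
  shows "structure_eqs x \<longleftrightarrow>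
    \<delta> (cfn F) x = (of_real \<kappa> * (l x + l' x) - 5 * of_real (vc x)) * of_real (F x) \<and>
    of_real (F x) * (Y l' x - Y' l x) = of_real (vc x * rc x + \<tau> x) * (l x - l' x) \<and>
    \<delta> l x = Y (cfn \<tau>) x + 2 * of_real (vc x) * l x - of_real \<kappa> * (l x)\<^sup>2 \<and>
    \<delta> l' x = Y' (cfn \<tau>) x + 2 * of_real (vc x) * l' x - of_real \<kappa> * (l' x)\<^sup>2"
proof -
  have F: "complex_of_real (F x) \<noteq> 0" using F_nonzero[OF assms] by simp
  have quot: "(A = B * of_real (F x)) \<longleftrightarrow> A / of_real (F x) = B"
    "(of_real (F x) * A = B) \<longleftrightarrow> A = B / of_real (F x)" for A B :: complex
    using F by (auto simp: field_simps)
  have \<alpha>: "\<alpha> x = 2 * of_real (vc x) - of_real \<kappa> * l x \<longleftrightarrow>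
      \<delta> (cfn F) x / of_real (F x) = of_real \<kappa> * (l x + l' x) - 5 * of_real (vc x)"
    unfolding coeff_dY_def by algebra
  have \<alpha>': "\<alpha>' x = 2 * of_real (vc x) - of_real \<kappa> * l' x \<longleftrightarrow>
      \<delta> (cfn F) x / of_real (F x) = of_real \<kappa> * (l x + l' x) - 5 * of_real (vc x)"
    unfolding coeff_dYbar_def by algebra
  \<comment> \<open>Inserting the value of the structure function produces the quadratic term in
    \<open>m\<close>, which is then taken to be \<open>l x\<close> or \<open>l' x\<close>.\<close>
  have sq: "D - E = A * m \<longleftrightarrow> D = E + 2 * of_real (vc x) * m - of_real \<kappa> * m\<^sup>2"
    if "A = 2 * of_real (vc x) - of_real \<kappa> * m" for A D E m :: complex
    unfolding that by algebra
  show ?thesis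
    unfolding structure_eqs_def quot
    using \<alpha> \<alpha>' sq[of "\<alpha> x" "l x"] sq[of "\<alpha>' x" "l' x"]
    by (auto simp: coeff_YYbar_def)
qed

section \<open>The formal Jacobi identity in components\<close>

definition jacobi_Y :: fn where
  "jacobi_Y x = \<delta> \<gamma> x - \<alpha>' x * \<gamma> x + Y' \<alpha> x"

definition jacobi_Y' :: fn where
  "jacobi_Y' x = \<alpha> x * \<gamma> x - \<delta> \<gamma> x - Y \<alpha>' x"

lemma differentiable_\<gamma>:
  assumes "x \<in> U"
  shows "\<gamma> differentiable at x"
proof -
  have "(\<lambda>x. (of_real (vc x) * of_real (rc x) + cfn \<tau> x) / cfn F x) differentiable at x"
    using F_nonzero[OF assms] differentiable[OF assms] differentiable_vc differentiable_rc
    by (intro differentiable_divide differentiable_add differentiable_mult) (simp_all add: cfn_def)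
  then show ?thesis by (simp add: coeff_YYbar_def cfn_def)
qed

lemma differentiable_\<alpha>:
  assumes "x \<in> U"
  shows "\<alpha> differentiable at x" "\<alpha>' differentiable at x"
proof -
  have "Ck_on 1 U (\<delta> (cfn F))"
    unfolding op_delta_eq_vfield using C2
    by (intro Ck_on_vfield open_U Ck_on_const Ck_on_flow_coeff)
       (auto intro: Ck_on_SucD simp: eval_nat_numeral simp del: Ck_on.simps)
  then have D: "\<delta> (cfn F) differentiable at x"
    using Ck_on_differentiable open_U assms zero_less_one by blast
  have quot: "(\<lambda>x. \<delta> (cfn F) x / cfn F x) differentiable at x"
    using D differentiable[OF assms] F_nonzero[OF assms]
    by (intro differentiable_divide) (simp_all add: cfn_def)
  show "\<alpha> differentiable at x" "\<alpha>' differentiable at x"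
    unfolding coeff_dY_def coeff_dYbar_def using quot differentiable[OF assms] differentiable_vc
    by (auto intro!: differentiable_diff differentiable_mult simp: cfn_def)
qed

text \<open>By the Leibniz rule the three summands are \<open>\<delta> \<gamma>\<close>
  (\<open>Y\<close> - \<open>Y'\<close>) + \<open>\<gamma>\<close> (\<open>\<alpha>\<close>
  \<open>Y\<close> - \<open>\<alpha>'\<close> \<open>Y'\<close>), then -(\<open>Y \<alpha>'\<close>)
  \<open>Y'\<close> - \<open>\<alpha>' \<gamma>\<close> (\<open>Y\<close> - \<open>Y'\<close>), then
  (\<open>Y' \<alpha>\<close>) \<open>Y\<close> - \<open>\<alpha> \<gamma>\<close> (\<open>Y\<close>
  - \<open>Y'\<close>). Collecting coefficients gives \<open>jacobi_Y\<close> and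
  \<open>jacobi_Y'\<close>.\<close>

lemma algebra_jacobi_iff:
  "algebra_jacobi U \<kappa> F \<tau> l \<longleftrightarrow> (\<forall>x\<in>U. jacobi_Y x = 0 \<and> jacobi_Y' x = 0)"
proof -
  let ?J = "comb_add (comb_bracket \<kappa> F \<tau> l gen_delta (comb_bracket \<kappa> F \<tau> l gen_Y gen_Ybar))
      (comb_add (comb_bracket \<kappa> F \<tau> l gen_Y (comb_bracket \<kappa> F \<tau> l gen_Ybar gen_delta))
        (comb_bracket \<kappa> F \<tau> l gen_Ybar (comb_bracket \<kappa> F \<tau> l gen_delta gen_Y)))"
  have neg: "\<delta> (\<lambda>x. - \<gamma> x) x = - \<delta> \<gamma> x" "Y (\<lambda>x. - \<alpha>' x) x = - Y \<alpha>' x" if "x \<in> U" for x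
    using differentiable_\<gamma>[OF that] differentiable_\<alpha>[OF that]
    by (simp_all add: op_eq_vfield vfield_minus)
  have const: "\<delta> (\<lambda>x. k) = (\<lambda>x. 0)" "Y (\<lambda>x. k) = (\<lambda>x. 0)" "Y' (\<lambda>x. k) = (\<lambda>x. 0)" for k
    by (simp_all add: fun_eq_iff op_eq_vfield)
  have "fst ?J x = 0 \<and> fst (snd ?J) x = jacobi_Y x \<and> snd (snd ?J) x = jacobi_Y' x" if "x \<in> U" for x
    using neg[OF that]
    by (simp add: comb_bracket_def comb_add_def comb_act_def gen_delta_def gen_Y_def gen_Ybar_def
        Let_def const jacobi_Y_def jacobi_Y'_def algebra_simps)
  then show ?thesis
    unfolding algebra_jacobi_def Let_def comb_zero_on_def by (auto simp: case_prod_beta)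
qed

text \<open>Instead of a quotient rule, the product of \<open>\<gamma>\<close> and
  \<open>cfn F\<close> is differentiated; on \<open>U\<close> it is v \<rho> + \<tau>, and
  \<open>\<delta>\<close> maps v to \<kappa> \<rho> - v^2 and \<rho> to \<tau>.\<close>

lemma \<delta>_\<gamma>:
  assumes "x \<in> U"
  shows "\<delta> \<gamma> x * of_real (F x) + \<gamma> x * \<delta> (cfn F) x =
    of_real ((\<kappa> * rc x - (vc x)\<^sup>2) * rc x + vc x * \<tau> x) + \<delta> (cfn \<tau>) x"
proof -
  have "\<delta> (\<lambda>y. \<gamma> y * cfn F y) x = \<delta> (\<lambda>y. of_real (vc y) * of_real (rc y) + cfn \<tau> y) x"
    unfolding op_delta_eq_vfield
    by (rule vfield_cong_open[OF open_U assms]) (simp add: coeff_YYbar_def cfn_def F_nonzero)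
  then show ?thesis
    using differentiable[OF assms] differentiable_\<gamma>[OF assms]
    by (simp add: op_delta_eq_vfield vfield_mult vfield_add differentiable_mult differentiable_vc
        differentiable_rc cfn_def algebra_simps)
qed

lemma operator_jacobi: "operator_jacobi U \<kappa> \<tau> l"
  unfolding operator_jacobi_def op_eq_vfield smooth_fn_on_def
  by (intro allI impI ballI vfield_jacobi[OF open_U] Ck_on_const Ck_on_flow_coeff C2 C2_l open_U) simp_all

text \<open>The structure equations are assumed on all of \<open>U\<close>, not only at
  \<open>x\<close>, so that the affine expressions for \<open>\<alpha>\<close> and
  \<open>\<alpha>'\<close> may be differentiated; the summand 2 is the derivative of 2 v.\<close>

lemma frame_derivatives_of_structure_coeffs:
  assumes "\<And>y. y \<in> U \<Longrightarrow> structure_eqs y" "x \<in> U"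
  shows "Y' \<alpha> x = 2 - of_real \<kappa> * Y' l x" "Y \<alpha>' x = 2 - of_real \<kappa> * Y l' x"
proof -
  have "Y' \<alpha> x = Y' (\<lambda>y. 2 * of_real (vc y) - of_real \<kappa> * l y) x"
    "Y \<alpha>' x = Y (\<lambda>y. 2 * of_real (vc y) - of_real \<kappa> * l' y) x"
    unfolding op_eq_vfield
    using assms(1) by (auto intro!: vfield_cong_open[OF open_U assms(2)] simp: structure_eqs_def)
  then show "Y' \<alpha> x = 2 - of_real \<kappa> * Y' l x" "Y \<alpha>' x = 2 - of_real \<kappa> * Y l' x"
    using differentiable[OF assms(2)]
    by (simp_all add: op_eq_vfield vfield_diff vfield_cmult differentiable_mult differentiable_vc)
qed

section \<open>Comparison of the Jacobi components with the last equation of the system\<close>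

definition \<tau>_defect :: fn where
  "\<tau>_defect x = of_real (F x) * (Y l' x + Y' l x)
     + of_real (vc x * rc x + \<tau> x) * (l x + l' x)
     - 2 * of_real \<kappa> * (\<delta> (cfn \<tau>) x
         + of_real (2 * F x + 4 * vc x * \<tau> x + \<kappa> * (rc x)\<^sup>2 + 2 * (vc x)\<^sup>2 * rc x))"

lemma resolving_system_iff:
  "resolving_system U \<kappa> F \<tau> l \<longleftrightarrow> (\<forall>x\<in>U. structure_eqs x \<and> \<tau>_defect x = 0)"
  unfolding resolving_system_def
proof (rule ball_cong[OF refl])
  fix x assume "x \<in> U"
  have "A = - B * C + D \<longleftrightarrow> A + B * C - D = 0" for A B C D :: complex
    by algebra
  then show "(\<delta> (cfn F) x = (of_real \<kappa> * (l x + l' x) - 5 * of_real (vc x)) * of_real (F x) \<and>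
     of_real (F x) * (Y l' x - Y' l x) = of_real (vc x * rc x + \<tau> x) * (l x - l' x) \<and>
     \<delta> l x = Y (cfn \<tau>) x + 2 * of_real (vc x) * l x - of_real \<kappa> * (l x)\<^sup>2 \<and>
     \<delta> l' x = Y' (cfn \<tau>) x + 2 * of_real (vc x) * l' x - of_real \<kappa> * (l' x)\<^sup>2 \<and>
     of_real (F x) * (Y l' x + Y' l x) = - of_real (vc x * rc x + \<tau> x) * (l x + l' x)
         + 2 * of_real \<kappa> * (\<delta> (cfn \<tau>) x
             + of_real (2 * F x + 4 * vc x * \<tau> x + \<kappa> * (rc x)\<^sup>2 + 2 * (vc x)\<^sup>2 * rc x)))
    \<longleftrightarrow> structure_eqs x \<and> \<tau>_defect x = 0"
    unfolding structure_eqs_iff[OF \<open>x \<in> U\<close>] \<tau>_defect_def by blast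
qed

text \<open>In \<open>jacobi_Y\<close> plus \<open>jacobi_Y'\<close> the terms with
  \<open>\<delta> \<gamma>\<close> cancel, and the rest vanishes by the relation for
  [\<open>Y\<close>, \<open>Y'\<close>]. Multiplication by \<open>F\<close> clears the denominator
  of \<open>\<gamma>\<close> and brings in the equation for \<open>\<delta> (cfn F)\<close>.\<close>

lemma jacobi_components:
  assumes "\<And>y. y \<in> U \<Longrightarrow> structure_eqs y" "x \<in> U"
  shows "jacobi_Y' x = - jacobi_Y x"
    and "2 * of_real (F x) * jacobi_Y x = - of_real \<kappa> * \<tau>_defect x"
proof -
  note eqs = assms(1)[OF assms(2), unfolded structure_eqs_def]
  note deriv = frame_derivatives_of_structure_coeffs[OF assms]
  have J: "jacobi_Y x = \<delta> \<gamma> x - (2 * of_real (vc x) - of_real \<kappa> * l' x) * \<gamma> x + 2 - of_real \<kappa> * Y' l x"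
    "jacobi_Y' x = (2 * of_real (vc x) - of_real \<kappa> * l x) * \<gamma> x - \<delta> \<gamma> x - 2 + of_real \<kappa> * Y l' x"
    using eqs by (simp_all add: jacobi_Y_def jacobi_Y'_def deriv)
  have \<gamma>: "Y l' x - Y' l x = \<gamma> x * (l x - l' x)" using eqs by blast
  have \<gamma>F: "\<gamma> x * of_real (F x) = of_real (vc x) * of_real (rc x) + of_real (\<tau> x)"
    using F_nonzero[OF assms(2)] by (simp add: coeff_YYbar_def)
  have \<delta>F: "\<delta> (cfn F) x = (of_real \<kappa> * (l x + l' x) - 5 * of_real (vc x)) * of_real (F x)"
    using structure_eqs_iff[OF assms(2)] assms(1)[OF assms(2)] by blast
  have \<delta>\<gamma>: "\<delta> \<gamma> x * of_real (F x) + \<gamma> x * \<delta> (cfn F) x =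
    (of_real \<kappa> * of_real (rc x) - (of_real (vc x))\<^sup>2) * of_real (rc x) + of_real (vc x) * of_real (\<tau> x)
      + \<delta> (cfn \<tau>) x"
    using \<delta>_\<gamma>[OF assms(2)] by simp
  show "jacobi_Y' x = - jacobi_Y x"
    unfolding J using arg_cong[OF \<gamma>, of "\<lambda>z. of_real \<kappa> * z"] by (simp add: algebra_simps)
  have D: "\<tau>_defect x = of_real (F x) * (Y l' x + Y' l x)
     + (of_real (vc x) * of_real (rc x) + of_real (\<tau> x)) * (l x + l' x)
     - 2 * of_real \<kappa> * (\<delta> (cfn \<tau>) x
         + (2 * of_real (F x) + 4 * of_real (vc x) * of_real (\<tau> x)
            + of_real \<kappa> * (of_real (rc x))\<^sup>2 + 2 * (of_real (vc x))\<^sup>2 * of_real (rc x)))"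
    by (simp add: \<tau>_defect_def)
  have F\<delta>\<gamma>: "of_real (F x) * \<delta> \<gamma> x =
    (of_real \<kappa> * of_real (rc x) - (of_real (vc x))\<^sup>2) * of_real (rc x) + of_real (vc x) * of_real (\<tau> x)
      + \<delta> (cfn \<tau>) x - (of_real \<kappa> * (l x + l' x) - 5 * of_real (vc x)) * (\<gamma> x * of_real (F x))"
    using \<delta>\<gamma> unfolding \<delta>F by (simp add: algebra_simps)
  have F\<gamma>: "of_real (F x) * Y l' x = of_real (F x) * Y' l x + (\<gamma> x * of_real (F x)) * (l x - l' x)"
    using arg_cong[OF \<gamma>, of "\<lambda>z. of_real (F x) * z"] by (simp add: algebra_simps)
  have "2 * of_real (F x) * jacobi_Y x = 2 * (of_real (F x) * \<delta> \<gamma> x)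
      - 2 * (2 * of_real (vc x) - of_real \<kappa> * l' x) * (\<gamma> x * of_real (F x))
      + 4 * of_real (F x) - 2 * of_real \<kappa> * (of_real (F x) * Y' l x)"
    unfolding J by (simp add: algebra_simps)
  \<comment> \<open>After \<open>Y l' x\<close>, \<open>\<delta> \<gamma> x\<close> and
    \<open>\<gamma> x\<close> are eliminated, a polynomial identity remains; it is checked for each
    of the two values of \<open>\<kappa>\<close>, whose square is 1.\<close>
  also have "\<dots> = - of_real \<kappa> * \<tau>_defect x"
    unfolding D distrib_left[of "of_real (F x)" "Y l' x"] F\<gamma> F\<delta>\<gamma> \<gamma>F
    using \<kappa> by (auto simp: algebra_simps power2_eq_square)
  finally show "2 * of_real (F x) * jacobi_Y x = - of_real \<kappa> * \<tau>_defect x" .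
qed

lemma jacobi_Y_eq_0_iff:
  assumes "\<And>y. y \<in> U \<Longrightarrow> structure_eqs y" "x \<in> U"
  shows "jacobi_Y x = 0 \<longleftrightarrow> \<tau>_defect x = 0"
  using jacobi_components(2)[OF assms] F_nonzero[OF assms(2)] \<kappa> by auto

lemma algebra_with_jacobi_iff:
  "commutator_algebra U \<kappa> F \<tau> l \<and> algebra_jacobi U \<kappa> F \<tau> l \<longleftrightarrow> resolving_system U \<kappa> F \<tau> l"
proof -
  have "jacobi_Y x = 0 \<and> jacobi_Y' x = 0 \<longleftrightarrow> \<tau>_defect x = 0"
    if "\<And>y. y \<in> U \<Longrightarrow> structure_eqs y" "x \<in> U" for x
    using jacobi_components(1)[OF that] jacobi_Y_eq_0_iff[OF that] by simp
  then show ?thesis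
    unfolding commutator_algebra_iff algebra_jacobi_iff resolving_system_iff by blast
qed

section \<open>The Jacobi identity of the operators under the commutation relations\<close>

lemma operator_jacobi_in_frame:
  assumes eqs: "\<And>y. y \<in> U \<Longrightarrow> structure_eqs y" and x: "x \<in> U" and f: "smooth_fn_on U f"
  shows "jacobi_Y x * Y f x + jacobi_Y' x * Y' f x = 0"
proof -
  have Ck: "Ck_on k U f" for k using f by (simp add: smooth_fn_on_def)
  have C2f: "Ck_on 2 U (\<delta> f)" "Ck_on 2 U (Y f)" "Ck_on 2 U (Y' f)"
    unfolding op_eq_vfield
    by (intro Ck_on_vfield Ck_on_const Ck_on_flow_coeff C2 C2_l open_U Ck)+
  have df: "\<delta> f differentiable at x" "Y f differentiable at x" "Y' f differentiable at x"
    using Ck_on_differentiable[OF _ open_U x] C2f zero_less_numeral by blast+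
  \<comment> \<open>Here a commutator is differentiated, so it is replaced on the whole open set
    \<open>U\<close>.\<close>
  have outer: "\<delta> (commut Y Y' f) x = \<delta> (\<lambda>y. \<gamma> y * (Y f y - Y' f y)) x"
    "Y (commut Y' \<delta> f) x = Y (\<lambda>y. - \<alpha>' y * Y' f y) x"
    "Y' (commut \<delta> Y f) x = Y' (\<lambda>y. \<alpha> y * Y f y) x"
    using commutation_relations[OF eqs _ Ck] unfolding op_eq_vfield
    by (auto intro!: vfield_cong_open[OF open_U x] simp: commut_def algebra_simps)
  have Leibniz: "\<delta> (\<lambda>y. \<gamma> y * (Y f y - Y' f y)) x
      = \<delta> \<gamma> x * (Y f x - Y' f x) + \<gamma> x * (\<delta> (Y f) x - \<delta> (Y' f) x)"
    "Y (\<lambda>y. - \<alpha>' y * Y' f y) x = - Y \<alpha>' x * Y' f x - \<alpha>' x * Y (Y' f) x"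
    "Y' (\<lambda>y. \<alpha> y * Y f y) x = Y' \<alpha> x * Y f x + \<alpha> x * Y' (Y f) x"
    using df differentiable_\<gamma>[OF x] differentiable_\<alpha>[OF x] unfolding op_eq_vfield
    by (simp_all add: vfield_mult vfield_diff vfield_minus)
  \<comment> \<open>Here the relations are needed only at \<open>x\<close>, but for the test
    functions \<open>\<delta> f\<close>, \<open>Y f\<close> and \<open>Y' f\<close>, which are of
    class C^2.\<close>
  have inner: "commut Y Y' (\<delta> f) x = \<gamma> x * (Y (\<delta> f) x - Y' (\<delta> f) x)"
    "commut Y' \<delta> (Y f) x = - \<alpha>' x * Y' (Y f) x"
    "commut \<delta> Y (Y' f) x = \<alpha> x * Y (Y' f) x"
    using commutation_relations[OF eqs[OF x] x] C2f by (auto simp: commut_def algebra_simps)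
  have "\<delta> (commut Y Y' f) x - commut Y Y' (\<delta> f) x
    + (Y (commut Y' \<delta> f) x - commut Y' \<delta> (Y f) x)
    + (Y' (commut \<delta> Y f) x - commut \<delta> Y (Y' f) x) = 0"
    using operator_jacobi f x unfolding operator_jacobi_def
    by (simp add: commut_def[of _ "commut _ _"])
  \<comment> \<open>The second-order terms left by the Leibniz rule regroup into commutators, to
    which the relations apply once more.\<close>
  then have "\<delta> \<gamma> x * (Y f x - Y' f x) + \<gamma> x * (commut \<delta> Y f x - commut \<delta> Y' f x)
      - Y \<alpha>' x * Y' f x - \<alpha>' x * commut Y Y' f x + Y' \<alpha> x * Y f x - \<alpha> x * commut Y Y' f x = 0"
    unfolding outer Leibniz inner by (simp add: commut_def algebra_simps)
  then show ?thesis
    unfolding jacobi_Y_def jacobi_Y'_def commutation_relations[OF eqs[OF x] x Ck]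
    by (simp add: algebra_simps)
qed

text \<open>The test function \<rho> is mapped to \<open>l\<close> by \<open>Y\<close> and to
  \<open>l'\<close> by \<open>Y'\<close>; as the two Jacobi components are opposite, the factor
  \<open>l x - l' x\<close> splits off and can be cancelled.\<close>

lemma \<tau>_defect_eq_0_if_independent:
  assumes "\<And>y. y \<in> U \<Longrightarrow> structure_eqs y" "x \<in> U" "l x \<noteq> l' x"
  shows "\<tau>_defect x = 0"
proof -
  have "jacobi_Y x * l x + jacobi_Y' x * l' x = 0"
    using operator_jacobi_in_frame[OF assms(1,2) coords_smooth(2)] by (simp add: op_eq_vfield)
  then have "jacobi_Y x * (l x - l' x) = 0"
    by (simp add: jacobi_components(1)[OF assms(1,2)] algebra_simps)
  then show ?thesis using assms jacobi_Y_eq_0_iff by simp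
qed

text \<open>Continuity serves to extend the vanishing of the defect from a dense subset to all of
  \<open>U\<close>.\<close>

lemma continuous_\<tau>_defect: "continuous_on U \<tau>_defect"
proof -
  have le2: "Ck_on k U F" "Ck_on k U \<tau>" "Ck_on k U l" "Ck_on k U l'" "Ck_on k U (cfn \<tau>)" if "k \<le> 2" for k
    using C2_F C2_\<tau> C2_l C2 that by (blast intro: Ck_on_mono)+
  have "Ck_on 0 U (Y l')" "Ck_on 0 U (Y' l)" "Ck_on 0 U (\<delta> (cfn \<tau>))"
    unfolding op_eq_vfield
    by (intro Ck_on_vfield Ck_on_const Ck_on_flow_coeff open_U le2; simp)+
  moreover note le2[of 0]
  ultimately show ?thesis
    unfolding \<tau>_defect_def[abs_def] by (auto intro!: continuous_intros)
qed

lemma algebra_with_operator_jacobi_iff: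
  assumes dense: "U \<subseteq> closure {x \<in> U. l x \<noteq> cnj (l x)}"
  shows "commutator_algebra U \<kappa> F \<tau> l \<and> operator_jacobi U \<kappa> \<tau> l \<longleftrightarrow> resolving_system U \<kappa> F \<tau> l"
proof -
  have "\<tau>_defect x = 0" if eqs: "\<And>y. y \<in> U \<Longrightarrow> structure_eqs y" and x: "x \<in> U" for x
  proof (rule ccontr)
    \<comment> \<open>If the defect were nonzero at \<open>x\<close>, it would be nonzero on this
      open set, which meets the dense set where \<open>l\<close> is not real.\<close>
    let ?V = "U \<inter> \<tau>_defect -` (- {0})"
    assume "\<tau>_defect x \<noteq> 0"
    then have "x \<in> ?V \<inter> closure {x \<in> U. l x \<noteq> cnj (l x)}" using x dense by auto
    moreover have "open ?V"
      by (rule continuous_open_preimage[OF continuous_\<tau>_defect open_U]) (simp add: open_Compl)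
    ultimately obtain y where "y \<in> ?V" "l y \<noteq> cnj (l y)"
      using open_Int_closure_eq_empty[of ?V] by blast
    then show False
      using \<tau>_defect_eq_0_if_independent[OF eqs, of y] by (auto simp: conj_fn_def)
  qed
  then show ?thesis
    unfolding commutator_algebra_iff resolving_system_iff using operator_jacobi by blast
qed

end

text \<open>The Jacobi identity is read in two ways: for formal combinations of independent
  generators, and for the operators on functions of (t, v, \<rho>). In the second reading, density
  of the points with non-real \<open>l\<close> supplies the independence of \<open>Y\<close> and its
  conjugate.\<close>

theorem theorem1:
  fixes U :: "(real \<times> real \<times> real) set"
    and \<kappa> :: real
    and F \<tau> :: "real \<times> real \<times> real \<Rightarrow> real"
    and l :: "real \<times> real \<times> real \<Rightarrow> complex"
  assumes "\<kappa> \<in> {1, -1}"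
    and "open U"
    and "Ck_on 2 U F" and "Ck_on 2 U \<tau>" and "Ck_on 2 U l"
    and "\<forall>x\<in>U. F x \<noteq> 0"
  shows "(commutator_algebra U \<kappa> F \<tau> l \<and> algebra_jacobi U \<kappa> F \<tau> l
            \<longleftrightarrow> resolving_system U \<kappa> F \<tau> l)
       \<and> (U \<subseteq> closure {x \<in> U. l x \<noteq> cnj (l x)} \<longrightarrow>
            (commutator_algebra U \<kappa> F \<tau> l \<and> operator_jacobi U \<kappa> \<tau> l
               \<longleftrightarrow> resolving_system U \<kappa> F \<tau> l))"
proof -
  interpret projected_operators U \<kappa> F \<tau> l
    using assms by unfold_locales auto
  show ?thesis
    using algebra_with_jacobi_iff algebra_with_operator_jacobi_iff by blast
qed

end
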